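(* Let $q$ be an odd power of $4$, i.e., $q=4^{2a+1}$ for a non-negative integer $a$. For all integers $t,m$ with $1\le t\le m\le\frac{q+2\sqrt q-8}{9}$, there is an optimal $q$-ary locally repairable code with length $n=9m\le q+2\sqrt q-r$, dimension $k=8t-7$, minimum distance $n-9t+9$ and locality $r=8$.
   Context: A linear code $C\subseteq\mathbb{F}_q^n$ has locality $r$ if for every $i\in\{1,\dots,n\}$ there is a subset $I_i\subseteq\{1,\dots,n\}\setminus\{i\}$ with $|I_i|\le r$ such that for any $\alpha\ne\beta$ in $\mathbb{F}_q$ the projections onto the coordinates $I_i$ of $\{c\in C:c_i=\alpha\}$ and $\{c\in C:c_i=\beta\}$ are disjoint. A locally repairable code here is a linear code over $\mathbb{F}_q$ with locality $r$; if it has length $n$, dimension $k$ and minimum distance $d$, it is optimal if it attains the Singleton-type bound, i.e. $d=n-k-\lceil k/r\rceil+2$. *)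

theory Defs
  imports "Jordan_Normal_Form.VS_Connect"
begin

text \<open>Coordinates of vectors of length \<open>n\<close> are indexed by \<open>0, \<dots>, n - 1\<close>.\<close>

definition linear_code :: "nat \<Rightarrow> 'a::field vec set \<Rightarrow> bool" where
  "linear_code n C \<longleftrightarrow> VectorSpace.subspace class_ring C (module_vec TYPE('a) n)"

definition code_dim :: "nat \<Rightarrow> 'a::field vec set \<Rightarrow> nat" where
  "code_dim n C = vectorspace.dim class_ring (module_vec TYPE('a) n\<lparr>carrier := C\<rparr>)"

definition hamming_dist :: "nat \<Rightarrow> 'a vec \<Rightarrow> 'a vec \<Rightarrow> nat" where
  "hamming_dist n x y = card {i. i < n \<and> x $ i \<noteq> y $ i}"

text \<open>Only meaningful for codes with at least two codewords.\<close>

definition min_dist :: "nat \<Rightarrow> 'a vec set \<Rightarrow> nat" where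
  "min_dist n C = Min {hamming_dist n x y | x y. x \<in> C \<and> y \<in> C \<and> x \<noteq> y}"

definition has_locality :: "nat \<Rightarrow> 'a vec set \<Rightarrow> nat \<Rightarrow> bool" where
  "has_locality n C r \<longleftrightarrow>
     (\<forall>i<n. \<exists>I. I \<subseteq> {..<n} - {i} \<and> card I \<le> r \<and>
        (\<forall>\<alpha> \<beta>. \<alpha> \<noteq> \<beta> \<longrightarrow>
           (\<lambda>c. restrict (($) c) I) ` {c \<in> C. c $ i = \<alpha>} \<inter>
           (\<lambda>c. restrict (($) c) I) ` {c \<in> C. c $ i = \<beta>} = {}))"

definition is_lrc :: "nat \<Rightarrow> nat \<Rightarrow> nat \<Rightarrow> nat \<Rightarrow> 'a::field vec set \<Rightarrow> bool" where
  "is_lrc n k d r C \<longleftrightarrow>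
     linear_code n C \<and> code_dim n C = k \<and> min_dist n C = d \<and> has_locality n C r"

definition is_optimal_lrc :: "nat \<Rightarrow> nat \<Rightarrow> nat \<Rightarrow> nat \<Rightarrow> 'a::field vec set \<Rightarrow> bool" where
  "is_optimal_lrc n k d r C \<longleftrightarrow>
     is_lrc n k d r C \<and> int d = int n - int k - \<lceil>real k / real r\<rceil> + 2"

end

theory Submission
  imports Defs "HOL-Number_Theory.Residues" "HOL-Computational_Algebra.Polynomial_Factorial"
    "Jordan_Normal_Form.DL_Rank"
begin

text \<open>The code is an evaluation code on the Fermat cubic \<open>u\<^sup>3 + v\<^sup>3 = 1\<close>, the supersingular
  elliptic curve with \<open>(\<surd>q + 1)\<^sup>2\<close> points over \<open>\<bbbF>\<^sub>q\<close>.  The group of order 9 that multiplies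
  \<open>u\<close> and \<open>v\<close> by cube roots of unity has the quotient map \<open>(u, v) \<mapsto> u\<^sup>3\<close>; its nine ramification points
  are all rational, and the other \<open>q + 2\<surd>q - 8\<close> rational points are the disjoint union of
  free orbits, which serve as repair groups.  The functions have poles of order at most \<open>3 (t - 1)\<close> at the
  three points at infinity and no component of type \<open>u\<^sup>2 v\<^sup>2\<close> under the group, so that
  \<open>\<Sum> u v f(u, v) = 0\<close> over each orbit.  The number of points comes from the exponential sum of
  \<open>x\<^sup>3\<close>, whose square is \<open>4 q\<close> and whose sign is determined modulo 3.  The bound on the number of zeros of
  \<open>f = a + b v + c v\<^sup>2\<close> is the degree of the norm of \<open>f\<close>, a polynomial in \<open>u\<close>.\<close>

section \<open>Cube roots of unity and an exponential sum in characteristic two\<close>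

text \<open>Multiplication by \<open>x\<close> permutes the nonzero elements, so their product is
  unchanged by the factor \<open>x ^ (q - 1)\<close>, where q is the size of the field.\<close>

lemma finite_field_power_card:
  fixes x :: "'a::{field,finite}"
  assumes "x \<noteq> 0"
  shows "x ^ (card (UNIV :: 'a set) - 1) = 1"
proof -
  have "\<Prod>(UNIV - {0::'a}) = (\<Prod>y\<in>UNIV - {0}. x * y)"
    by (rule prod.reindex_bij_witness[of _ "\<lambda>y. x * y" "\<lambda>y. y / x"]) (use assms in auto)
  also have "\<dots> = x ^ (card (UNIV :: 'a set) - 1) * \<Prod>(UNIV - {0})"
    by (simp add: prod.distrib)
  finally show ?thesis
    by simp
qed

text \<open>With q - 1 = 3e, the polynomial X^e - 1 has at most e roots among the 3e nonzero
  elements; the e-th power of a nonroot is a cube root of unity other than 1.\<close>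

lemma exists_primitive_cube_root:
  assumes "3 dvd card (UNIV :: 'a::{field,finite} set) - 1"
  obtains w :: "'a::{field,finite}" where "w \<noteq> 1" "w ^ 3 = 1" "w\<^sup>2 + w + 1 = 0"
proof -
  obtain e where e: "card (UNIV :: 'a set) - 1 = 3 * e"
    using assms by blast
  have "card {0, 1 :: 'a} \<le> card (UNIV :: 'a set)"
    by (rule card_mono) auto
  hence "e > 0"
    using e by auto
  define p :: "'a poly" where "p = Polynomial.monom 1 e - 1"
  have "poly.coeff p e = 1"
    using \<open>e > 0\<close> by (simp add: p_def)
  hence "p \<noteq> 0"
    by auto
  have "degree p \<le> e"
    unfolding p_def by (rule degree_diff_le) (auto simp: degree_monom_le)
  hence "card {x. poly p x = 0} \<le> e"
    using card_poly_roots_bound[OF \<open>p \<noteq> 0\<close>] by simp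
  moreover have "card (UNIV - {0 :: 'a}) = 3 * e"
    using e by simp
  ultimately have "\<not> UNIV - {0} \<subseteq> {x. poly p x = 0}"
    using card_mono[of "{x. poly p x = 0}" "UNIV - {0 :: 'a}"] \<open>e > 0\<close> by auto
  then obtain x where x: "x \<noteq> 0" "poly p x \<noteq> 0"
    by blast
  define w where "w = x ^ e"
  have "w \<noteq> 1"
    using x by (simp add: p_def poly_monom w_def)
  moreover have "w ^ 3 = 1"
    using finite_field_power_card[OF \<open>x \<noteq> 0\<close>]
    unfolding w_def e by (simp add: mult.commute flip: power_mult)
  moreover have "(w - 1) * (w\<^sup>2 + w + 1) = w ^ 3 - 1"
    by Groebner_Basis.algebra
  ultimately show ?thesis
    using that by auto
qed

lemma char_two_of_card:
  assumes "card (UNIV :: 'a::{field,finite} set) = 2 ^ e"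
  shows "(2::'a) = 0"
proof -
  have "CHAR('a) > 0"
    by (rule finite_imp_CHAR_pos) simp
  hence "prime CHAR('a)"
    by (rule prime_CHAR_semidom)
  moreover have "CHAR('a) dvd 2 ^ e"
    using CHAR_dvd_CARD[where ?'a = 'a] assms by simp
  ultimately have "CHAR('a) = 2"
    using prime_dvd_power primes_dvd_imp_eq two_is_prime_nat by blast
  thus ?thesis
    using of_nat_CHAR[where ?'a = 'a] by simp
qed

section \<open>Fibres of the cubing map and their power sums\<close>

locale cube_root_of_unity =
  fixes w :: "'a::field"
  assumes root: "w\<^sup>2 + w + 1 = 0"
    and three_neq_0: "(3::'a) \<noteq> 0"
begin

lemma w_cube: "w ^ 3 = 1"
  using root by Groebner_Basis.algebra

lemma w_nonzero: "w \<noteq> 0"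
  using root by auto

lemma w_neq_1: "w \<noteq> 1"
  using root three_neq_0 by auto

lemma w_sq_neq_1: "w\<^sup>2 \<noteq> 1"
proof
  assume "w\<^sup>2 = 1"
  hence "w = w ^ 3"
    by (simp add: power3_eq_cube power2_eq_square)
  thus False
    using w_cube w_neq_1 by simp
qed

lemma cube_roots: "{y. y ^ 3 = x ^ 3} = {x, w * x, w\<^sup>2 * (x::'a)}"
proof -
  have "y ^ 3 - x ^ 3 = (y - x) * (y - w * x) * (y - w\<^sup>2 * x)" for y
    using root by Groebner_Basis.algebra
  hence "y ^ 3 = x ^ 3 \<longleftrightarrow> y = x \<or> y = w * x \<or> y = w\<^sup>2 * x" for y
    by (simp add: eq_iff_diff_eq_0[of "y ^ 3"])
  thus ?thesis
    by auto
qed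

lemma card_cube_roots:
  fixes x :: 'a
  assumes "x \<noteq> 0"
  shows "card {y. y ^ 3 = x ^ 3} = 3"
proof -
  have "w * x \<noteq> x" "w\<^sup>2 * x \<noteq> x" "w\<^sup>2 * x \<noteq> w * x"
    using assms w_neq_1 w_sq_neq_1 w_nonzero by (auto simp: power2_eq_square)
  thus ?thesis
    unfolding cube_roots by (auto simp: card_insert_if)
qed

text \<open>Multiplication by \<open>w\<close> permutes the fibre and scales the sum by
  \<open>w ^ k\<close>, which differs from 1. These vanishing sums later give the short dual
  codewords.\<close>

lemma sum_power_cube_roots:
  fixes x :: 'a
  assumes "\<not> 3 dvd k"
  shows "(\<Sum>y | y ^ 3 = x ^ 3. y ^ k) = 0"
proof -
  have "(\<Sum>y | y ^ 3 = x ^ 3. y ^ k) = (\<Sum>y | y ^ 3 = x ^ 3. (w * y) ^ k)"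
    by (rule sum.reindex_bij_witness[of _ "\<lambda>y. w * y" "\<lambda>y. y / w"])
       (use w_nonzero w_cube in \<open>auto simp: power_mult_distrib power_divide\<close>)
  also have "\<dots> = w ^ k * (\<Sum>y | y ^ 3 = x ^ 3. y ^ k)"
    by (simp add: power_mult_distrib sum_distrib_left)
  finally have "(w ^ k - 1) * (\<Sum>y | y ^ 3 = x ^ 3. y ^ k) = 0"
    by (simp add: algebra_simps)
  moreover have "w ^ k = w ^ (k mod 3)"
    by (metis div_mult_mod_eq mult.commute mult_1 power_add power_mult power_one w_cube)
  moreover have "k mod 3 = 1 \<or> k mod 3 = 2"
    using assms by presburger
  ultimately show ?thesis
    using w_neq_1 w_sq_neq_1 by auto
qed

end

section \<open>The additive character of a finite field of characteristic two\<close>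

locale char_two_field = cube_root_of_unity w for w :: "'a::{field,finite}" +
  assumes two_eq_0: "(2::'a) = 0"
begin

lemma add_self [simp]: "x + x = (0::'a)"
  using two_eq_0 by (metis mult_2 mult_zero_left)

lemma minus_eq: "- x = (x::'a)"
  using add_self[of x] by (metis add_eq_0_iff)

lemma diff_eq: "x - y = x + (y::'a)"
  using minus_eq[of y] by (metis diff_conv_add_uminus)

lemma add_cancel_char_two [simp]: "x + (x + y) = (y::'a)"
  by (metis add.assoc add_self add_0)

lemma add_eq_0_char_two: "x + y = 0 \<longleftrightarrow> x = (y::'a)"
  using diff_eq[of x y] by (metis eq_iff_diff_eq_0)

lemma w_add_w_sq: "w + w\<^sup>2 = 1"
  using root minus_eq[of 1] by (metis add.commute add.left_commute eq_neg_iff_add_eq_0)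

lemma square_add: "(x + y)\<^sup>2 = x\<^sup>2 + (y::'a)\<^sup>2"
  by (simp add: power2_sum two_eq_0)

lemma bij_square: "bij (\<lambda>x::'a. x\<^sup>2)"
proof -
  have "inj (\<lambda>x::'a. x\<^sup>2)"
    by (rule injI) (metis add_eq_0_char_two square_add zero_eq_power2)
  thus ?thesis
    by (simp add: bij_def finite_UNIV_inj_surj)
qed

text \<open>By Artin--Schreier theory \<open>AS\<close> is the kernel of the absolute trace, so \<open>chi\<close> is the
  canonical additive character.\<close>

definition AS :: "'a set" where
  "AS = range (\<lambda>y. y\<^sup>2 + y)"

lemma zero_in_AS: "0 \<in> AS"
  by (auto simp: AS_def intro!: image_eqI[of _ _ 0])

definition chi :: "'a \<Rightarrow> int" where
  "chi x = (if x \<in> AS then 1 else - 1)"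

lemma AS_add: "x \<in> AS \<Longrightarrow> y \<in> AS \<Longrightarrow> x + y \<in> AS"
proof -
  assume "x \<in> AS" "y \<in> AS"
  then obtain a b where "x = a\<^sup>2 + a" "y = b\<^sup>2 + b"
    by (auto simp: AS_def)
  hence "x + y = (a + b)\<^sup>2 + (a + b)"
    by (simp add: square_add algebra_simps)
  thus ?thesis
    by (auto simp: AS_def)
qed

lemma AS_fibre: "x = (y::'a)\<^sup>2 + y \<Longrightarrow> {z. z\<^sup>2 + z = x} = {y, y + 1}"
proof -
  assume x: "x = (y::'a)\<^sup>2 + y"
  have "z\<^sup>2 + z = x \<longleftrightarrow> (z + y) * (z + y + 1) = 0" for z :: 'a
  proof -
    have "(z + y) * (z + y + 1) = (z + y)\<^sup>2 + (z + y)"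
      by (simp add: power2_eq_square algebra_simps)
    also have "\<dots> = (z\<^sup>2 + z) + x"
      by (simp add: x square_add algebra_simps)
    finally show ?thesis
      by (simp add: add_eq_0_char_two)
  qed
  moreover have "z + y + 1 = 0 \<longleftrightarrow> z = y + 1" for z :: 'a
    using add_eq_0_char_two[of z "y + 1"] by (simp add: add.assoc)
  ultimately show ?thesis
    by (auto simp: add_eq_0_char_two)
qed

lemma card_AS_fibre: "int (card {y. y\<^sup>2 + y = x}) = 1 + chi x"
proof (cases "x \<in> AS")
  case True
  then obtain y where y: "x = y\<^sup>2 + y"
    by (auto simp: AS_def)
  have "y \<noteq> y + 1"
    by simp
  thus ?thesis
    using True unfolding AS_fibre[OF y] by (simp add: chi_def)
next
  case False
  hence "{y. y\<^sup>2 + y = x} = {}"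
    by (auto simp: AS_def)
  thus ?thesis
    using False by (simp add: chi_def)
qed

text \<open>Adding 1 to each \<open>chi x\<close> counts the preimages of \<open>x\<close> under y^2
  + y; over all \<open>x\<close> this counts every \<open>y\<close> once, so the ones already
  account for the total.\<close>

lemma sum_chi: "(\<Sum>x\<in>UNIV. chi x) = 0"
proof -
  have "(\<Sum>x\<in>UNIV. 1 + chi x) = (\<Sum>x\<in>UNIV. int (card {y::'a. y\<^sup>2 + y = x}))"
    by (simp only: card_AS_fibre)
  also have "\<dots> = int (card (UNIV :: 'a set))"
    using sum.group[of UNIV UNIV "\<lambda>y. y\<^sup>2 + y" "\<lambda>_::'a. 1::int"] by simp
  finally show ?thesis
    by (simp add: sum.distrib)
qed

lemma card_AS: "2 * card AS = card (UNIV :: 'a set)"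
proof -
  have "0 = (\<Sum>x\<in>AS. chi x) + (\<Sum>x\<in>-AS. chi x)"
    using sum_chi sum.subset_diff[of AS UNIV chi] by (simp add: Compl_eq_Diff_UNIV)
  also have "\<dots> = int (card AS) - int (card (- AS))"
    by (simp add: chi_def)
  finally have "card (- AS) = card AS"
    by simp
  thus ?thesis
    using card_Un_disjoint[of AS "- AS"] by simp
qed

text \<open>\<open>AS\<close> is an additive subgroup with half of the elements, so its translate by
  \<open>x\<close>, being disjoint from it, is the whole complement.\<close>

lemma AS_add_notin:
  assumes "x \<notin> AS" "y \<notin> AS"
  shows "x + y \<in> AS"
proof -
  have "(+) x ` AS \<subseteq> - AS"
  proof clarify
    fix z assume "z \<in> AS" "x + z \<in> AS"
    hence "(x + z) + z \<in> AS"
      using AS_add by blast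
    thus False
      using assms(1) by (simp add: add.assoc)
  qed
  moreover have "card ((+) x ` AS) = card (- AS)"
    using card_AS card_Un_disjoint[of AS "- AS"] by (simp add: card_image)
  ultimately have "(+) x ` AS = - AS"
    by (intro card_subset_eq) auto
  then obtain z where "z \<in> AS" "y = x + z"
    using assms(2) by blast
  thus ?thesis
    by simp
qed

lemma chi_add: "chi (x + y) = chi x * chi y"
proof -
  have "x + y \<in> AS \<longleftrightarrow> y \<in> AS" if "x \<in> AS"
    using AS_add[of x y] AS_add[of x "x + y"] that by auto
  moreover have "x + y \<in> AS" if "x \<notin> AS" "y \<notin> AS"
    using AS_add_notin that .
  moreover have "x + y \<notin> AS" if "x \<notin> AS" "y \<in> AS"
    using AS_add[of "x + y" y] that by (auto simp: add.assoc)
  ultimately show ?thesis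
    by (cases "x \<in> AS"; cases "y \<in> AS") (simp_all add: chi_def)
qed

text \<open>Since x^2 + x lies in \<open>AS\<close>, multiplicativity makes the product of the two
  values equal to 1.\<close>

lemma chi_power2: "chi (x\<^sup>2) = chi x"
proof -
  have "chi (x\<^sup>2 + x) = 1"
    by (auto simp: chi_def AS_def)
  thus ?thesis
    unfolding chi_add by (auto simp: chi_def split: if_splits)
qed

section \<open>The exponential sum of the cube\<close>

text \<open>Squaring is a bijection, so this is orthogonality for the characters
  \<open>chi (c * x)\<close>.\<close>

lemma sum_chi_mult_square:
  "(\<Sum>x\<in>UNIV. chi (c * x\<^sup>2)) = (if c = 0 then int (card (UNIV :: 'a set)) else 0)"
proof (cases "c = 0")
  case True
  thus ?thesis
    using zero_in_AS by (simp add: chi_def)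
next
  case False
  have "(\<Sum>x\<in>UNIV. chi (c * x\<^sup>2)) = (\<Sum>x\<in>UNIV. chi (c * x))"
    using sum.reindex_bij_betw[OF bij_square, of "\<lambda>x. chi (c * x)"] .
  also have "\<dots> = (\<Sum>x\<in>UNIV. chi x)"
    by (rule sum.reindex_bij_witness[of _ "\<lambda>x. x / c" "\<lambda>x. c * x"]) (use False in auto)
  finally show ?thesis
    using False sum_chi by simp
qed

text \<open>Replacing \<open>x d\<^sup>2\<close> by its Frobenius conjugate makes the mixed part of \<open>(x + d)\<^sup>3\<close>
  linear in \<open>x\<^sup>2\<close>.\<close>

lemma chi_mixed: "chi (x\<^sup>2 * d + x * d\<^sup>2) = chi ((d + d ^ 4) * x\<^sup>2)"
proof -
  have "chi (x\<^sup>2 * d + x * d\<^sup>2) = chi (x\<^sup>2 * d) * chi ((x * d\<^sup>2)\<^sup>2)"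
    by (simp only: chi_add chi_power2)
  also have "\<dots> = chi (x\<^sup>2 * d + (x * d\<^sup>2)\<^sup>2)"
    by (simp add: chi_add)
  also have "x\<^sup>2 * d + (x * d\<^sup>2)\<^sup>2 = (d + d ^ 4) * x\<^sup>2"
    by Groebner_Basis.algebra
  finally show ?thesis .
qed

text \<open>In characteristic two the zeros of d^4 + d = d^4 - d are the elements of the subfield of
  order four.\<close>

lemma add_pow4_eq_0_iff: "(d::'a) + d ^ 4 = 0 \<longleftrightarrow> d \<in> {0, 1, w, w\<^sup>2}"
proof -
  have "d + d ^ 4 = d * (d - 1) * (d - w) * (d - w\<^sup>2) + 2 * d"
    using root by Groebner_Basis.algebra
  hence "d + d ^ 4 = d * (d - 1) * (d - w) * (d - w\<^sup>2)"
    by (simp only: two_eq_0 mult_zero_left add_0_right)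
  thus ?thesis
    by simp
qed

text \<open>Expand the square and substitute y = x + d. For fixed d the sum over x is a sum over a
  multiple of x^2, which vanishes unless d lies in the subfield of order four; each of these four d
  contributes the size of the field.\<close>

lemma cube_sum_squared: "(\<Sum>x\<in>UNIV. chi (x ^ 3))\<^sup>2 = 4 * int (card (UNIV :: 'a set))"
proof -
  have cube: "x ^ 3 + (x + d) ^ 3 = d ^ 3 + (x\<^sup>2 * d + x * d\<^sup>2)" for x d :: 'a
  proof -
    have "x ^ 3 + (x + d) ^ 3 = d ^ 3 + (x\<^sup>2 * d + x * d\<^sup>2) + 2 * (x ^ 3 + x\<^sup>2 * d + x * d\<^sup>2)"
      by Groebner_Basis.algebra
    thus ?thesis
      by (simp add: two_eq_0)
  qed
  have shift: "(\<Sum>y\<in>UNIV. chi (x ^ 3 + y ^ 3)) = (\<Sum>d\<in>UNIV. chi (x ^ 3 + (x + d) ^ 3))" for x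
    by (rule sum.reindex_bij_witness[of _ "\<lambda>d. x + d" "\<lambda>y. x + y"]) auto
  have "(\<Sum>x\<in>UNIV. chi (x ^ 3))\<^sup>2 = (\<Sum>x\<in>UNIV. \<Sum>y\<in>UNIV. chi (x ^ 3 + y ^ 3))"
    by (simp add: power2_eq_square sum_product chi_add)
  also have "\<dots> = (\<Sum>x\<in>UNIV. \<Sum>d\<in>UNIV. chi (x ^ 3 + (x + d) ^ 3))"
    by (simp only: shift)
  also have "\<dots> = (\<Sum>d\<in>UNIV. \<Sum>x\<in>UNIV. chi (d ^ 3) * chi ((d + d ^ 4) * x\<^sup>2))"
    by (subst sum.swap) (simp only: cube chi_add[of "_ ^ 3"] chi_mixed)
  also have "\<dots> = (\<Sum>d\<in>UNIV. if d \<in> {0, 1, w, w\<^sup>2} then chi (d ^ 3) * int (card (UNIV :: 'a set)) else 0)"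
    by (simp only: sum_distrib_left[symmetric] sum_chi_mult_square add_pow4_eq_0_iff) (auto intro!: sum.cong)
  also have "\<dots> = (\<Sum>d\<in>{0, 1, w, w\<^sup>2}. chi (d ^ 3) * int (card (UNIV :: 'a set)))"
    by (rule sum.mono_neutral_cong_right) auto
  also have "\<dots> = (\<Sum>d\<in>{0, 1, w, w\<^sup>2}. int (card (UNIV :: 'a set)))"
  proof (rule sum.cong[OF refl])
    fix d assume "d \<in> {0, 1, w, w\<^sup>2}"
    moreover have "(w\<^sup>2) ^ 3 = 1"
      using w_cube by Groebner_Basis.algebra
    ultimately have "d ^ 3 = 0 \<or> d ^ 3 = 1"
      using w_cube by auto
    \<comment> \<open>The preimage is \<open>w\<close>, because w^2 + w = 1 in characteristic
      two.\<close>
    moreover have "1 \<in> AS"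
      unfolding AS_def by (rule range_eqI[of _ _ w]) (simp add: w_add_w_sq add.commute)
    ultimately show "chi (d ^ 3) * int (card (UNIV :: 'a set)) = int (card (UNIV :: 'a set))"
      using zero_in_AS by (auto simp: chi_def)
  qed
  also have "\<dots> = 4 * int (card (UNIV :: 'a set))"
  proof -
    have "w\<^sup>2 \<noteq> w"
      using w_nonzero w_neq_1 by (simp add: power2_eq_square)
    hence "card {0, 1, w, w\<^sup>2} = 4"
      using w_nonzero w_neq_1 w_sq_neq_1 by (auto simp: card_insert_if)
    thus ?thesis
      by simp
  qed
  finally show ?thesis .
qed

text \<open>The nonzero \<open>x\<close> fall into cubing fibres of size three on which the summand
  is constant; \<open>x = 0\<close> contributes 1.\<close>

lemma cube_sum_mod_3: "3 dvd (\<Sum>x\<in>UNIV. chi (x ^ 3)) - 1"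
proof -
  have "(\<Sum>x\<in>UNIV. chi (x ^ 3)) = chi 0 + (\<Sum>x\<in>-{0}. chi (x ^ 3))"
    using sum.remove[of UNIV 0 "\<lambda>x. chi (x ^ 3)"] by (simp add: Compl_eq_Diff_UNIV)
  also have "chi 0 = 1"
    using zero_in_AS by (simp add: chi_def)
  finally have "(\<Sum>x\<in>UNIV. chi (x ^ 3)) - 1 = (\<Sum>x\<in>-{0}. chi (x ^ 3))"
    by simp
  also have "\<dots> = (\<Sum>c\<in>(\<lambda>x. x ^ 3) ` (- {0}). \<Sum>x | x \<in> - {0} \<and> x ^ 3 = c. chi (x ^ 3))"
    by (rule sum.group[symmetric]) auto
  also have "3 dvd \<dots>"
  proof (rule dvd_sum)
    fix c :: 'a
    assume "c \<in> (\<lambda>x. x ^ 3) ` (- {0})"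
    then obtain x where x: "x \<noteq> 0" "c = x ^ 3"
      by auto
    have "{y. y \<in> - {0} \<and> y ^ 3 = c} = {y. y ^ 3 = x ^ 3}"
      using x by auto
    hence "card {y. y \<in> - {0} \<and> y ^ 3 = c} = 3"
      using card_cube_roots[OF x(1)] by simp
    moreover have "(\<Sum>y | y \<in> - {0} \<and> y ^ 3 = c. chi (y ^ 3)) = (\<Sum>y | y \<in> - {0} \<and> y ^ 3 = c. chi c)"
      by (rule sum.cong) auto
    ultimately show "3 dvd (\<Sum>y | y \<in> - {0} \<and> y ^ 3 = c. chi (y ^ 3))"
      by simp
  qed
  finally show ?thesis .
qed

text \<open>The square leaves the values 2s and -2s; for s congruent to 2 modulo 3 only 2s is
  congruent to 1.\<close>

lemma cube_sum_eq:
  assumes "card (UNIV :: 'a set) = s\<^sup>2" and "s mod 3 = 2"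
  shows "(\<Sum>x\<in>UNIV. chi (x ^ 3)) = 2 * int s"
proof -
  have "(\<Sum>x\<in>UNIV. chi (x ^ 3))\<^sup>2 = (2 * int s)\<^sup>2"
    using cube_sum_squared assms(1) by (simp add: power_mult_distrib)
  hence "(\<Sum>x\<in>UNIV. chi (x ^ 3)) = 2 * int s \<or> (\<Sum>x\<in>UNIV. chi (x ^ 3)) = - 2 * int s"
    unfolding power2_eq_iff by simp
  thus ?thesis
    using cube_sum_mod_3 assms(2) by presburger
qed

section \<open>Point counts on the supersingular curve and on the Fermat cubic\<close>

text \<open>Each \<open>x\<close> carries \<open>1 + chi (x ^ 3)\<close> points. With the point at
  infinity the total is (s + 1)^2, the maximum in the Hasse bound.\<close>

lemma card_weierstrass:
  assumes "card (UNIV :: 'a set) = s\<^sup>2" and "s mod 3 = 2"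
  shows "card {(x, y::'a). y\<^sup>2 + y = x ^ 3} = s\<^sup>2 + 2 * s"
proof -
  have "{(x, y::'a). y\<^sup>2 + y = x ^ 3} = (SIGMA x:UNIV. {y. y\<^sup>2 + y = x ^ 3})"
    by auto
  hence "int (card {(x, y::'a). y\<^sup>2 + y = x ^ 3}) = (\<Sum>x\<in>UNIV. int (card {y::'a. y\<^sup>2 + y = x ^ 3}))"
    by simp
  also have "\<dots> = (\<Sum>x\<in>UNIV. 1 + chi (x ^ 3))"
    by (simp only: card_AS_fibre)
  also have "\<dots> = int (s\<^sup>2 + 2 * s)"
    using cube_sum_eq[OF assms] assms(1) by (simp add: sum.distrib)
  finally show ?thesis
    by (simp only: of_nat_eq_iff)
qed

text \<open>The points on the coordinate axes are left out because the group of order nine does not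
  act freely there.\<close>

definition fermat_points :: "('a \<times> 'a) set" where
  "fermat_points = {(u, v). u \<noteq> 0 \<and> v \<noteq> 0 \<and> u ^ 3 + v ^ 3 = 1}"

text \<open>The supersingular curve \<open>y\<^sup>2 + y = x\<^sup>3\<close> is isomorphic to the Fermat cubic because
  \<open>(y + w)\<^sup>3 + (y + w\<^sup>2)\<^sup>3 = y\<^sup>2 + y\<close>; the eight discarded points are those that go to
  infinity or to a coordinate axis.\<close>

lemma card_fermat_points:
  assumes "card (UNIV :: 'a set) = s\<^sup>2" and "s mod 3 = 2"
  shows "s\<^sup>2 + 2 * s \<le> card fermat_points + 8"
proof -
  define E where "E = {(x, y::'a). y\<^sup>2 + y = x ^ 3}"
  define B :: "('a \<times> 'a) set" where "B = {0} \<times> {0, 1} \<union> {x. x ^ 3 = 1 ^ 3} \<times> {w, w\<^sup>2}"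
  define f where "f = (\<lambda>(x, y). ((y + w) / x, (y + w\<^sup>2) / x))"
  have "card B \<le> card ({0::'a} \<times> {0::'a, 1}) + card ({x::'a. x ^ 3 = 1 ^ 3} \<times> {w, w\<^sup>2})"
    unfolding B_def by (rule card_Un_le)
  also have "\<dots> = 2 + 3 * card {w, w\<^sup>2}"
    by (simp only: card_cartesian_product card_cube_roots[OF one_neq_zero]) simp
  also have "\<dots> \<le> 8"
    using card_insert_le_m1[of 2 "{w\<^sup>2}" w] by simp
  finally have "card B \<le> 8" .
  have *: "x \<noteq> 0 \<and> y + w \<noteq> 0 \<and> y + w\<^sup>2 \<noteq> 0" if "(x, y) \<in> E - B" for x y
  proof -
    have eq: "y\<^sup>2 + y = x ^ 3" and notin: "(x, y) \<notin> B"
      using that by (auto simp: E_def)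
    have "x \<noteq> 0"
    proof
      assume "x = 0"
      hence "y * (y + 1) = 0"
        using eq by (simp add: power2_eq_square algebra_simps)
      hence "y = 0 \<or> y = 1"
        using add_eq_0_char_two[of y 1] by auto
      thus False
        using notin \<open>x = 0\<close> by (auto simp: B_def)
    qed
    moreover have "y + w \<noteq> 0"
    proof
      assume "y + w = 0"
      hence "y = w"
        by (simp only: add_eq_0_char_two)
      moreover from this have "x ^ 3 = 1"
        using eq w_add_w_sq by (simp add: add.commute)
      ultimately show False
        using notin by (simp add: B_def)
    qed
    moreover have "y + w\<^sup>2 \<noteq> 0"
    proof
      assume "y + w\<^sup>2 = 0"
      hence "y = w\<^sup>2"
        by (simp only: add_eq_0_char_two)
      moreover have "(w\<^sup>2)\<^sup>2 = w"
        using w_cube by Groebner_Basis.algebra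
      ultimately have "y = w\<^sup>2" "x ^ 3 = 1"
        using eq w_add_w_sq by simp_all
      thus False
        using notin by (simp add: B_def)
    qed
    ultimately show ?thesis
      by blast
  qed
  have "f ` (E - B) \<subseteq> fermat_points"
  proof (rule image_subsetI)
    fix P assume "P \<in> E - B"
    then obtain x y where P: "P = (x, y)" and xy: "(x, y) \<in> E" "(x, y) \<notin> B"
      by (cases P) auto
    \<comment> \<open>This holds modulo w^2 + w + 1 in any characteristic; the summand with factor 2
      then disappears.\<close>
    have "(y + w) ^ 3 + (y + w\<^sup>2) ^ 3 = y\<^sup>2 + y + 2 * (y ^ 3 + 1 - 2 * y\<^sup>2 - 2 * y)"
      using root by Groebner_Basis.algebra
    also have "\<dots> = y\<^sup>2 + y"
      by (simp only: two_eq_0 mult_zero_left add_0_right)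
    also have "\<dots> = x ^ 3"
      using xy by (simp add: E_def)
    finally have "((y + w) / x) ^ 3 + ((y + w\<^sup>2) / x) ^ 3 = 1"
      using *[of x y] xy by (simp add: power_divide flip: add_divide_distrib)
    thus "f P \<in> fermat_points"
      using *[of x y] xy P by (simp add: f_def fermat_points_def)
  qed
  moreover have "inj_on f (E - B)"
  proof (rule inj_onI)
    fix P Q assume PQ: "P \<in> E - B" "Q \<in> E - B" and f_eq: "f P = f Q"
    then obtain x y x' y' where P: "P = (x, y)" and Q: "Q = (x', y')" and xy: "(x, y) \<in> E - B"
      by (cases P, cases Q) auto
    \<comment> \<open>The sum of the image coordinates is 1/x, so the image determines
      \<open>x\<close> and then \<open>y\<close>.\<close>
    have sum: "(y + w) / x + (y + w\<^sup>2) / x = 1 / x" for x y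
    proof -
      have "(y + w) + (y + w\<^sup>2) = 2 * y + 1"
        using w_add_w_sq by Groebner_Basis.algebra
      hence "(y + w) + (y + w\<^sup>2) = 1"
        by (simp only: two_eq_0 mult_zero_left add_0_left)
      thus ?thesis
        by (simp flip: add_divide_distrib)
    qed
    have u: "(y + w) / x = (y' + w) / x'" and v: "(y + w\<^sup>2) / x = (y' + w\<^sup>2) / x'"
      using f_eq by (auto simp: f_def P Q)
    have "1 / x = 1 / x'"
      using sum[of y x] sum[of y' x'] u v by simp
    hence "x = x'"
      by simp
    thus "P = Q"
      using u *[OF xy] by (simp add: P Q)
  qed
  ultimately have "card (E - B) \<le> card fermat_points"
    by (intro card_inj_on_le[of f]) auto
  moreover have "card E - card B \<le> card (E - B)"
    by (rule diff_card_le_card_Diff) simp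
  ultimately show ?thesis
    using card_weierstrass[OF assms] \<open>card B \<le> 8\<close> by (simp add: E_def)
qed

end

section \<open>Zeros of functions on the Fermat cubic\<close>

text \<open>This is the norm of a + b v + c v^2 when v is adjoined with v^3 = g.\<close>

definition cubic_norm :: "'a::comm_ring_1 \<Rightarrow> 'a \<Rightarrow> 'a \<Rightarrow> 'a \<Rightarrow> 'a" where
  "cubic_norm g a b c = a ^ 3 + b ^ 3 * g + c ^ 3 * g\<^sup>2 - 3 * a * b * c * g"

lemma cubic_norm_eq_0_of_root:
  fixes v :: "'a::idom"
  assumes "v ^ 3 = g" "a + b * v + c * v\<^sup>2 = 0"
  shows "cubic_norm g a b c = 0"
proof -
  have a: "a = - (b * v + c * v\<^sup>2)"
    using assms(2) by (metis add.assoc eq_neg_iff_add_eq_0)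
  show ?thesis
    unfolding cubic_norm_def a assms(1)[symmetric] by Groebner_Basis.algebra
qed

lemma poly_cubic_norm [simp]:
  "poly (cubic_norm g a b c) x = cubic_norm (poly g x) (poly a x) (poly b x) (poly c x)"
  by (simp add: cubic_norm_def)

text \<open>The chain rule, grouped by the partial derivatives in \<open>a\<close>,
  \<open>b\<close>, \<open>c\<close> and \<open>g\<close>, so that a common zero of these four
  factors is visibly a zero of the derivative.\<close>

lemma poly_pderiv_cubic_norm:
  fixes g :: "'a::idom poly"
  shows "poly (pderiv (cubic_norm g a b c)) x =
    3 * ((poly a x)\<^sup>2 - poly b x * poly c x * poly g x) * poly (pderiv a) x
    + 3 * ((poly b x)\<^sup>2 - poly a x * poly c x) * poly g x * poly (pderiv b) x
    + 3 * ((poly c x)\<^sup>2 * poly g x - poly a x * poly b x) * poly g x * poly (pderiv c) x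
    + ((poly b x) ^ 3 + 2 * (poly c x) ^ 3 * poly g x - 3 * poly a x * poly b x * poly c x)
        * poly (pderiv g) x"
  by (simp add: cubic_norm_def pderiv_add pderiv_diff pderiv_mult power3_eq_cube power2_eq_square
      algebra_simps)

section \<open>Multiplicities of the zeros of the norm\<close>

lemma order_ge_2:
  fixes p :: "'a::idom poly"
  assumes "p \<noteq> 0" "poly p x = 0" "poly (pderiv p) x = 0"
  shows "2 \<le> order x p"
proof -
  obtain q where q: "p = [:- x, 1:] * q"
    using assms(2) by (auto simp: poly_eq_0_iff_dvd elim: dvdE)
  have "poly q x = 0"
    using assms(3) unfolding q pderiv_mult by (simp add: pderiv_pCons del: mult_pCons_left)
  hence "[:- x, 1:] ^ 2 dvd p"
    unfolding q power2_eq_square by (intro mult_dvd_mono dvd_refl) (simp add: poly_eq_0_iff_dvd)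
  thus ?thesis
    using assms(1) order_divides by blast
qed

text \<open>By Vieta b = -c (v1 + v2) and a = c v1 v2, while equal cubes of distinct elements give
  v1^2 + v1 v2 + v2^2 = 0. Each expression is a multiple of the latter; up to factors 3 and
  \<open>g\<close> they are the partial derivatives of the norm form.\<close>

lemma quadratic_two_cube_roots:
  fixes a b c g :: "'a::idom"
  assumes "v1 \<noteq> v2" "v1 ^ 3 = g" "v2 ^ 3 = g"
    and r1: "a + b * v1 + c * v1\<^sup>2 = 0" and r2: "a + b * v2 + c * v2\<^sup>2 = 0"
  shows "a\<^sup>2 - b * c * g = 0" "b\<^sup>2 - a * c = 0" "c\<^sup>2 * g - a * b = 0"
    "b ^ 3 + 2 * c ^ 3 * g - 3 * a * b * c = 0"
proof -
  have "(v1 - v2) * (b + c * (v1 + v2)) = (a + b * v1 + c * v1\<^sup>2) - (a + b * v2 + c * v2\<^sup>2)"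
    by Groebner_Basis.algebra
  hence "b + c * (v1 + v2) = 0"
    using \<open>v1 \<noteq> v2\<close> r1 r2 by simp
  hence b: "b = - (c * (v1 + v2))"
    by (simp only: eq_neg_iff_add_eq_0)
  have "a - c * v1 * v2 = a + b * v1 + c * v1\<^sup>2"
    unfolding b by Groebner_Basis.algebra
  hence a: "a = c * v1 * v2"
    using r1 by simp
  have "(v1 - v2) * (v1\<^sup>2 + v1 * v2 + v2\<^sup>2) = v1 ^ 3 - v2 ^ 3"
    by Groebner_Basis.algebra
  hence v: "v1\<^sup>2 + v1 * v2 + v2\<^sup>2 = 0"
    using assms(1-3) by simp
  have "a\<^sup>2 - b * c * v1 ^ 3 = c\<^sup>2 * v1\<^sup>2 * (v1\<^sup>2 + v1 * v2 + v2\<^sup>2)"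
    unfolding a b by Groebner_Basis.algebra
  thus "a\<^sup>2 - b * c * g = 0"
    by (simp add: v assms(2))
  have "b\<^sup>2 - a * c = c\<^sup>2 * (v1\<^sup>2 + v1 * v2 + v2\<^sup>2)"
    unfolding a b by Groebner_Basis.algebra
  thus "b\<^sup>2 - a * c = 0"
    by (simp add: v)
  have "c\<^sup>2 * v1 ^ 3 - a * b = c\<^sup>2 * v1 * (v1\<^sup>2 + v1 * v2 + v2\<^sup>2)"
    unfolding a b by Groebner_Basis.algebra
  thus "c\<^sup>2 * g - a * b = 0"
    by (simp add: v assms(2))
  have "b ^ 3 + 2 * c ^ 3 * v1 ^ 3 - 3 * a * b * c = c ^ 3 * (v1 - v2) * (v1\<^sup>2 + v1 * v2 + v2\<^sup>2)"
    unfolding a b by Groebner_Basis.algebra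
  thus "b ^ 3 + 2 * c ^ 3 * g - 3 * a * b * c = 0"
    by (simp add: v assms(2))
qed

lemma order_cubic_norm_ge_2:
  fixes g :: "'a::idom poly"
  assumes "cubic_norm g a b c \<noteq> 0" and "v1 \<noteq> v2"
    and v1: "v1 ^ 3 = poly g x" "poly a x + poly b x * v1 + poly c x * v1\<^sup>2 = 0"
    and v2: "v2 ^ 3 = poly g x" "poly a x + poly b x * v2 + poly c x * v2\<^sup>2 = 0"
  shows "2 \<le> order x (cubic_norm g a b c)"
proof (rule order_ge_2)
  show "poly (cubic_norm g a b c) x = 0"
    using cubic_norm_eq_0_of_root[OF v1] by simp
  show "poly (pderiv (cubic_norm g a b c)) x = 0"
    unfolding poly_pderiv_cubic_norm
      quadratic_two_cube_roots[OF \<open>v1 \<noteq> v2\<close> v1(1) v2(1) v1(2) v2(2)]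
    by simp
qed (fact assms(1))

text \<open>If all three coefficients vanish at \<open>x\<close>, the fibre has at most three points
  and the norm has a triple zero. Otherwise a nonzero polynomial of degree at most two in v leaves
  at most two points: one makes the norm vanish, two make its derivative vanish as well.\<close>

lemma card_roots_le_order_cubic_norm:
  fixes g :: "'a::idom poly"
  assumes N: "cubic_norm g a b c \<noteq> 0"
  shows "card {v. v ^ 3 = poly g x \<and> poly a x + poly b x * v + poly c x * v\<^sup>2 = 0}
    \<le> order x (cubic_norm g a b c)"
    (is "card ?Z \<le> order x ?N")
proof (cases "poly a x = 0 \<and> poly b x = 0 \<and> poly c x = 0")
  case True
  define p where "p = Polynomial.monom 1 3 - [:poly g x:]"
  have "poly.coeff p 3 = 1"
    by (simp add: p_def coeff_pCons eval_nat_numeral)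
  hence "p \<noteq> 0"
    by auto
  hence "card {v. poly p v = 0} \<le> degree p" and "finite {v. poly p v = 0}"
    by (simp_all add: card_poly_roots_bound poly_roots_finite)
  moreover have "degree p \<le> 3"
    unfolding p_def by (rule degree_diff_le) (auto simp: degree_monom_le)
  moreover have "?Z \<subseteq> {v. poly p v = 0}"
    by (auto simp: p_def poly_monom)
  ultimately have "card ?Z \<le> 3"
    by (meson card_mono le_trans)
  moreover obtain a' b' c' where "a = [:- x, 1:] * a'" "b = [:- x, 1:] * b'" "c = [:- x, 1:] * c'"
    using True by (auto simp: poly_eq_0_iff_dvd elim!: dvdE)
  \<comment> \<open>The norm form is homogeneous of degree three in the coefficients.\<close>
  hence "?N = [:- x, 1:] ^ 3 * cubic_norm g a' b' c'"
    unfolding cubic_norm_def by Groebner_Basis.algebra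
  hence "3 \<le> order x ?N"
    using N order_divides dvd_triv_left by metis
  ultimately show ?thesis
    by linarith
next
  case False
  define p where "p = [:poly a x, poly b x, poly c x:]"
  have "p \<noteq> 0"
    using False by (auto simp: p_def)
  hence "card {v. poly p v = 0} \<le> degree p" and fin: "finite {v. poly p v = 0}"
    by (simp_all add: card_poly_roots_bound poly_roots_finite)
  moreover have "degree p \<le> 2"
    by (simp add: p_def)
  moreover have sub: "?Z \<subseteq> {v. poly p v = 0}"
    by (auto simp: p_def algebra_simps power2_eq_square)
  ultimately have "card ?Z \<le> 2"
    by (meson card_mono le_trans)
  have "finite ?Z"
    using fin sub finite_subset by blast
  consider "card ?Z = 0" | "card ?Z = 1" | "card ?Z = 2"
    using \<open>card ?Z \<le> 2\<close> by linarith
  thus ?thesis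
  proof cases
    case 2
    then obtain v where "?Z = {v}"
      by (rule card_1_singletonE)
    hence "poly ?N x = 0"
      using cubic_norm_eq_0_of_root[of v "poly g x" "poly a x" "poly b x" "poly c x"] by auto
    hence "order x ?N > 0"
      using N order_gt_0_iff by blast
    thus ?thesis
      using 2 by simp
  next
    case 3
    then obtain v1 v2 where v: "?Z = {v1, v2}" "v1 \<noteq> v2"
      by (auto simp: card_2_iff)
    hence "v1 \<in> ?Z" "v2 \<in> ?Z"
      by auto
    thus ?thesis
      using 3 order_cubic_norm_ge_2[OF N v(2), of x] by simp
  qed simp
qed

text \<open>Over a totally ramified prime the three terms \<open>a\<^sup>3\<close>, \<open>b\<^sup>3 g\<close>, \<open>c\<^sup>3 g\<^sup>2\<close> have distinct
  valuations modulo 3, so the norm form is anisotropic.\<close>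

lemma cubic_norm_descent:
  fixes p :: "'a::idom"
  assumes p: "prime_elem p" "\<not> p dvd h" and N: "cubic_norm (p * h) a b c = 0"
  obtains a' b' c' where "a = p * a'" "b = p * b'" "c = p * c'" "cubic_norm (p * h) a' b' c' = 0"
proof -
  have "p \<noteq> 0"
    using p(1) by auto
  have "a ^ 3 = p * (3 * a * b * c * h - b ^ 3 * h - c ^ 3 * p * h\<^sup>2)"
    using N unfolding cubic_norm_def by Groebner_Basis.algebra
  hence "p dvd a"
    using p(1) prime_elem_dvd_power by (metis dvd_triv_left)
  then obtain a' where a: "a = p * a'" ..
  \<comment> \<open>Once \<open>p\<close> divides \<open>a\<close>, all terms of the norm other than
    \<open>b ^ 3 * p * h\<close> are divisible by p^2, which forces \<open>p\<close> to divide
    \<open>b\<close>; the same argument with p^3 treats \<open>c\<close>.\<close>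
  have "p * (b ^ 3 * h) = p * (p * (3 * a' * b * c * h - p * a' ^ 3 - c ^ 3 * h\<^sup>2))"
    using N unfolding cubic_norm_def a by Groebner_Basis.algebra
  hence "b ^ 3 * h = p * (3 * a' * b * c * h - p * a' ^ 3 - c ^ 3 * h\<^sup>2)"
    using \<open>p \<noteq> 0\<close> by simp
  hence "p dvd b"
    using p prime_elem_dvd_power by (metis dvd_triv_left prime_elem_dvd_multD)
  then obtain b' where b: "b = p * b'" ..
  have "p\<^sup>2 * (c ^ 3 * h\<^sup>2) = p\<^sup>2 * (p * (3 * a' * b' * c * h - a' ^ 3 - p * b' ^ 3 * h))"
    using N unfolding cubic_norm_def a b by Groebner_Basis.algebra
  hence "c ^ 3 * h\<^sup>2 = p * (3 * a' * b' * c * h - a' ^ 3 - p * b' ^ 3 * h)"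
    using \<open>p \<noteq> 0\<close> by simp
  hence "p dvd c"
    using p prime_elem_dvd_power by (metis dvd_triv_left prime_elem_dvd_multD)
  then obtain c' where c: "c = p * c'" ..
  have "p ^ 3 * cubic_norm (p * h) a' b' c' = 0"
    using N unfolding cubic_norm_def a b c by Groebner_Basis.algebra
  hence "cubic_norm (p * h) a' b' c' = 0"
    using \<open>p \<noteq> 0\<close> by simp
  thus ?thesis
    using that a b c by blast
qed

lemma cubic_norm_eq_0_imp_power_dvd:
  fixes p :: "'a::idom"
  assumes "prime_elem p" "\<not> p dvd h" "cubic_norm (p * h) a b c = 0"
  shows "p ^ n dvd a \<and> p ^ n dvd b \<and> p ^ n dvd c"
  using assms(3)
proof (induction n arbitrary: a b c)
  case (Suc n)
  obtain a' b' c' where "a = p * a'" "b = p * b'" "c = p * c'" "cubic_norm (p * h) a' b' c' = 0"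
    using cubic_norm_descent[OF assms(1,2) Suc.prems] .
  thus ?case
    using Suc.IH[of a' b' c'] by (simp add: mult_dvd_mono)
qed simp

text \<open>As 3 is nonzero, X - 1 is a simple factor of 1 - X^3, and the descent makes
  \<open>a\<close>, \<open>b\<close>, \<open>c\<close> divisible by all its powers. So a nonzero
  function has a nonzero norm.\<close>

lemma cubic_norm_eq_0_iff:
  fixes a b c :: "'a::field poly"
  assumes "(3::'a) \<noteq> 0"
  shows "cubic_norm (1 - Polynomial.monom 1 3) a b c = 0 \<longleftrightarrow> a = 0 \<and> b = 0 \<and> c = 0"
proof
  assume N: "cubic_norm (1 - Polynomial.monom 1 3) a b c = 0"
  define p h :: "'a poly" where "p = [:- 1, 1:]" and "h = [:- 1, - 1, - 1:]"
  have "1 - Polynomial.monom 1 3 = p * h"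
    by (simp add: p_def h_def monom_altdef eval_nat_numeral one_pCons)
  hence N': "cubic_norm (p * h) a b c = 0"
    using N by simp
  have "prime_elem p"
    unfolding p_def by (intro prime_elem_linear_field_poly) simp
  moreover have "poly h 1 \<noteq> 0"
    using assms by (simp add: h_def)
  hence "\<not> p dvd h"
    unfolding p_def by (simp add: poly_eq_0_iff_dvd)
  ultimately have "p ^ n dvd a \<and> p ^ n dvd b \<and> p ^ n dvd c" for n
    using N' by (rule cubic_norm_eq_0_imp_power_dvd)
  moreover have "f = 0" if "\<And>n. p ^ n dvd f" for f
  proof (rule ccontr)
    assume "f \<noteq> 0"
    hence "degree (p ^ Suc (degree f)) \<le> degree f"
      using that by (intro dvd_imp_degree_le)
    moreover have "degree (p ^ Suc (degree f)) = Suc (degree f)"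
      unfolding p_def by (rule degree_linear_power)
    ultimately show False
      by simp
  qed
  ultimately show "a = 0 \<and> b = 0 \<and> c = 0"
    by blast
qed (simp add: cubic_norm_def)

section \<open>The degree of the norm and the bound on the number of zeros\<close>

text \<open>With weight 1 for v and 3 for \<open>g\<close>, every term has weight at most 3D. The
  alternatives \<open>b = 0\<close> and \<open>c = 0\<close> cover values of \<open>D\<close> too
  small for these terms, since the zero polynomial has degree 0.\<close>

lemma degree_cubic_norm_le:
  fixes a b c g :: "'a::idom poly"
  assumes "degree g \<le> 3" "degree a \<le> D" "b = 0 \<or> degree b + 1 \<le> D" "c = 0 \<or> degree c + 2 \<le> D"
  shows "degree (cubic_norm g a b c) \<le> 3 * D"
proof -
  have a: "degree (a ^ 3) \<le> 3 * D"
    using degree_power_le[of a 3] assms(2) by linarith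
  have b: "degree (b ^ 3 * g) \<le> 3 * D"
    using degree_mult_le[of "b ^ 3" g] degree_power_le[of b 3] assms by fastforce
  have c: "degree (c ^ 3 * g\<^sup>2) \<le> 3 * D"
    using degree_mult_le[of "c ^ 3" "g\<^sup>2"] degree_power_le[of c 3] degree_power_le[of g 2] assms
    by fastforce
  have d: "degree (3 * a * b * c * g) \<le> 3 * D"
  proof (cases "b = 0 \<or> c = 0")
    case False
    have "degree (3 * a * b * c * g) \<le> degree (3 :: 'a poly) + degree a + degree b + degree c + degree g"
      by (meson add_le_mono degree_mult_le le_refl le_trans)
    thus ?thesis
      using False assms by simp
  qed auto
  show ?thesis
    unfolding cubic_norm_def by (intro degree_diff_le degree_add_le a b c d)
qed

text \<open>This is Bezout's bound for the intersection with a curve of degree \<open>D\<close>.\<close>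

lemma card_zeros_on_fermat_cubic:
  fixes a b c :: "'a::{field,finite} poly"
  assumes "(3::'a) \<noteq> 0" and "a \<noteq> 0 \<or> b \<noteq> 0 \<or> c \<noteq> 0"
    and deg: "degree a \<le> D" "b = 0 \<or> degree b + 1 \<le> D" "c = 0 \<or> degree c + 2 \<le> D"
  shows "card {(u, v). u ^ 3 + v ^ 3 = 1 \<and> poly a u + poly b u * v + poly c u * v\<^sup>2 = 0} \<le> 3 * D"
proof -
  define g where "g = 1 - Polynomial.monom (1::'a) 3"
  define N where "N = cubic_norm g a b c"
  define Z where "Z u = {v. v ^ 3 = poly g u \<and> poly a u + poly b u * v + poly c u * v\<^sup>2 = 0}" for u
  have "N \<noteq> 0"
    unfolding N_def g_def using assms(1,2) cubic_norm_eq_0_iff by blast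
  have "u ^ 3 + v ^ 3 = 1 \<longleftrightarrow> v ^ 3 = poly g u" for u v
    by (auto simp: g_def poly_monom algebra_simps)
  hence "{(u, v). u ^ 3 + v ^ 3 = 1 \<and> poly a u + poly b u * v + poly c u * v\<^sup>2 = 0} = (SIGMA u:UNIV. Z u)"
    by (auto simp: Z_def)
  hence "card {(u, v). u ^ 3 + v ^ 3 = 1 \<and> poly a u + poly b u * v + poly c u * v\<^sup>2 = 0}
      = (\<Sum>u\<in>UNIV. card (Z u))"
    by simp
  \<comment> \<open>The zeros are counted fibrewise over \<open>u\<close> and each fibre is bounded
    by the order of the norm there; the orders add up to at most its degree.\<close>
  also have "\<dots> \<le> (\<Sum>u\<in>UNIV. order u N)"
    unfolding Z_def N_def using \<open>N \<noteq> 0\<close>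
    by (intro sum_mono card_roots_le_order_cubic_norm) (simp add: N_def)
  also have "\<dots> = size (proots N)"
    unfolding size_multiset_overloaded_eq using \<open>N \<noteq> 0\<close>
    by (intro sum.mono_neutral_cong_right) (auto simp: order_eq_0_iff)
  also have "\<dots> \<le> degree N"
    by (rule size_proots_le)
  also have "degree g \<le> 3"
    unfolding g_def by (rule degree_diff_le) (auto simp: degree_monom_le)
  hence "degree N \<le> 3 * D"
    unfolding N_def by (rule degree_cubic_norm_le[OF _ deg])
  finally show ?thesis .
qed

section \<open>Evaluation codes\<close>

lemma matrix_code:
  fixes A :: "'a::field mat"
  assumes A: "A \<in> carrier_mat n k"
    and inj: "\<And>x. x \<in> carrier_vec k \<Longrightarrow> A *\<^sub>v x = 0\<^sub>v n \<Longrightarrow> x = 0\<^sub>v k"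
  shows "linear_code n ((*\<^sub>v) A ` carrier_vec k)"
    and "code_dim n ((*\<^sub>v) A ` carrier_vec k) = k"
proof -
  interpret vec_space "TYPE('a)" n .
  have C: "(*\<^sub>v) A ` carrier_vec k = span (set (cols A))"
    using col_space_eq[OF A] A by (auto simp: col_space_def)
  have cols: "set (cols A) \<subseteq> carrier_vec n"
    using A cols_dim by blast
  show "linear_code n ((*\<^sub>v) A ` carrier_vec k)"
    unfolding linear_code_def C using cols by (intro span_is_subspace) simp
  have unit: "A *\<^sub>v unit_vec k i = col A i" if "i < k" for i
    using A that by (intro eq_vecI) (auto simp: scalar_prod_right_unit)
  \<comment> \<open>The span is taken over a set, so repeated columns must be excluded: they would
    put a difference of two unit vectors into the kernel.\<close>
  have "distinct (cols A)"
    unfolding distinct_conv_nth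
  proof (intro allI impI)
    fix i j assume ij: "i < length (cols A)" "j < length (cols A)" "i \<noteq> j"
    hence ij': "i < k" "j < k"
      using A by auto
    show "cols A ! i \<noteq> cols A ! j"
    proof
      assume eq: "cols A ! i = cols A ! j"
      have "A *\<^sub>v (unit_vec k i - unit_vec k j) = A *\<^sub>v unit_vec k i - A *\<^sub>v unit_vec k j"
        using A by (intro mult_minus_distrib_mat_vec) auto
      also have "\<dots> = col A i - col A j"
        using ij' by (simp add: unit)
      also have "\<dots> = 0\<^sub>v n"
        using eq A ij' by auto
      finally have "unit_vec k i - unit_vec k j = (0\<^sub>v k :: 'a vec)"
        using inj[of "unit_vec k i - unit_vec k j"] by simp
      hence "(unit_vec k i - unit_vec k j) $ i = (0::'a)"
        using ij' by simp
      thus False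
        using ij' ij(3) by simp
    qed
  qed
  moreover have "lin_indpt (set (cols A))"
    using lin_depE[OF A _ \<open>distinct (cols A)\<close>] inj by blast
  ultimately have "rank A = k"
    by (intro lin_indpt_full_rank A)
  thus "code_dim n ((*\<^sub>v) A ` carrier_vec k) = k"
    by (simp add: code_dim_def C rank_def)
qed

section \<open>Parameters and locality of evaluation codes\<close>

locale evaluation_code =
  fixes J :: "'j set" and F :: "'j \<Rightarrow> 'p \<Rightarrow> 'a::field" and P :: "'p set"
    and pt :: "nat \<Rightarrow> 'p" and n :: nat
  assumes finite_J: "finite J" and pt: "bij_betw pt {..<n} P"
begin

definition pt_val :: "('j \<Rightarrow> 'a) \<Rightarrow> 'p \<Rightarrow> 'a" where
  "pt_val g p = (\<Sum>j\<in>J. g j * F j p)"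

definition ev :: "('j \<Rightarrow> 'a) \<Rightarrow> 'a vec" where
  "ev g = vec n (\<lambda>i. pt_val g (pt i))"

lemma finite_P: "finite P" and card_P: "card P = n"
  using pt bij_betw_finite bij_betw_same_card by fastforce+

lemma pt_val_diff: "pt_val (\<lambda>j. g j - g' j) p = pt_val g p - pt_val g' p"
  by (simp add: pt_val_def left_diff_distrib sum_subtractf)

lemma card_indices: "card {i. i < n \<and> Q (pt i)} = card {p \<in> P. Q p}"
proof (rule bij_betw_same_card)
  have "pt ` {i. i < n \<and> Q (pt i)} = {p \<in> P. Q p}"
    using bij_betw_imp_surj_on[OF pt] by auto
  thus "bij_betw pt {i. i < n \<and> Q (pt i)} {p \<in> P. Q p}"
    using pt by (auto simp: bij_betw_def intro: inj_on_subset)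
qed

lemma hamming_dist_ev:
  "hamming_dist n (ev g) (ev g') = n - card {p \<in> P. pt_val (\<lambda>j. g j - g' j) p = 0}"
proof -
  have "hamming_dist n (ev g) (ev g') = card {i. i < n \<and> pt_val g (pt i) \<noteq> pt_val g' (pt i)}"
    unfolding hamming_dist_def by (rule arg_cong[of _ _ card]) (auto simp: ev_def)
  also have "\<dots> = card {p \<in> P. pt_val g p \<noteq> pt_val g' p}"
    by (rule card_indices)
  also have "{p \<in> P. pt_val g p \<noteq> pt_val g' p} = P - {p \<in> P. pt_val (\<lambda>j. g j - g' j) p = 0}"
    by (auto simp: pt_val_diff)
  also have "card \<dots> = n - card {p \<in> P. pt_val (\<lambda>j. g j - g' j) p = 0}"
    using finite_P card_P by (subst card_Diff_subset) auto
  finally show ?thesis .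
qed

text \<open>This passes from coefficient families on \<open>J\<close> to coordinate vectors; the
  second conjunct turns a nonzero vector into a family that is nonzero on \<open>J\<close>, as the
  kernel argument requires.\<close>

lemma matrix_representation:
  "\<exists>A\<in>carrier_mat n (card J). range ev = (*\<^sub>v) A ` carrier_vec (card J) \<and>
    (\<forall>x\<in>carrier_vec (card J). x \<noteq> 0\<^sub>v (card J) \<longrightarrow> (\<exists>g. A *\<^sub>v x = ev g \<and> (\<exists>j\<in>J. g j \<noteq> 0)))"
proof -
  define k where "k = card J"
  obtain idx where idx: "bij_betw idx {..<k} J"
    using ex_bij_betw_nat_finite[OF finite_J] by (auto simp: k_def atLeast0LessThan)
  define A where "A = mat n k (\<lambda>(i, l). F (idx l) (pt i))"
  define lift where "lift x j = x $ inv_into {..<k} idx j" for x :: "'a vec" and j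
  have A: "A \<in> carrier_mat n k"
    by (simp add: A_def)
  have mult: "A *\<^sub>v x = ev g" if "x \<in> carrier_vec k" "\<And>l. l < k \<Longrightarrow> x $ l = g (idx l)" for x g
  proof (rule eq_vecI)
    fix i assume "i < dim_vec (ev g)"
    hence i: "i < n"
      by (simp add: ev_def)
    have "(A *\<^sub>v x) $ i = (\<Sum>l\<in>{..<k}. F (idx l) (pt i) * g (idx l))"
      using i that by (simp add: A_def scalar_prod_def atLeast0LessThan)
    also have "\<dots> = pt_val g (pt i)"
      unfolding pt_val_def using sum.reindex_bij_betw[OF idx, of "\<lambda>j. F j (pt i) * g j"]
      by (simp add: mult.commute)
    finally show "(A *\<^sub>v x) $ i = ev g $ i"
      using i by (simp add: ev_def)
  qed (simp add: A_def ev_def)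
  have lift: "x $ l = lift x (idx l)" if "l < k" for x l
    using that idx by (simp add: lift_def bij_betw_def)
  show ?thesis
  proof (rule bexI[OF _ A[unfolded k_def]], unfold k_def[symmetric], intro conjI ballI impI)
    show "range ev = (*\<^sub>v) A ` carrier_vec k"
    proof (intro subset_antisym subsetI)
      fix c assume "c \<in> range ev"
      then obtain g where "c = ev g"
        by blast
      hence "c = A *\<^sub>v vec k (\<lambda>l. g (idx l))"
        by (subst mult[of _ g]) auto
      thus "c \<in> (*\<^sub>v) A ` carrier_vec k"
        by auto
    qed (use mult lift in \<open>force\<close>)
    show "\<exists>g. A *\<^sub>v x = ev g \<and> (\<exists>j\<in>J. g j \<noteq> 0)" if x: "x \<in> carrier_vec k" "x \<noteq> 0\<^sub>v k" for x
    proof -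
      obtain l where "l < k" "x $ l \<noteq> 0"
        using x by (metis carrier_vecD eq_vecI index_zero_vec)
      moreover have "idx l \<in> J"
        using idx \<open>l < k\<close> by (auto simp: bij_betw_def)
      ultimately show ?thesis
        using mult[OF x(1) lift] lift[of l x] by metis
    qed
  qed
qed

text \<open>A nonzero family has at most \<open>z < n\<close> zeros, so evaluation is injective on
  families on \<open>J\<close>. The distance is \<open>n\<close> minus the largest number of zeros,
  attained by \<open>g0\<close>.\<close>

lemma parameters:
  assumes zeros_le: "\<And>g. \<exists>j\<in>J. g j \<noteq> 0 \<Longrightarrow> card {p \<in> P. pt_val g p = 0} \<le> z"
    and zeros_eq: "card {p \<in> P. pt_val g0 p = 0} = z" and "z < n"
  shows "linear_code n (range ev)" "code_dim n (range ev) = card J" "min_dist n (range ev) = n - z"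
proof -
  obtain A where A: "A \<in> carrier_mat n (card J)" and range: "range ev = (*\<^sub>v) A ` carrier_vec (card J)"
    and nz: "\<And>x. x \<in> carrier_vec (card J) \<Longrightarrow> x \<noteq> 0\<^sub>v (card J) \<Longrightarrow> \<exists>g. A *\<^sub>v x = ev g \<and> (\<exists>j\<in>J. g j \<noteq> 0)"
    using matrix_representation by blast
  have ev_nz: "ev g \<noteq> 0\<^sub>v n" if "\<exists>j\<in>J. g j \<noteq> 0" for g
  proof
    assume "ev g = 0\<^sub>v n"
    hence "ev g $ i = 0" if "i < n" for i
      using that by simp
    hence "pt_val g p = 0" if "p \<in> P" for p
      using that pt by (auto simp: ev_def bij_betw_def)
    hence "{p \<in> P. pt_val g p = 0} = P"
      by blast
    thus False
      using zeros_le[OF that] \<open>z < n\<close> card_P by simp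
  qed
  have inj: "x = 0\<^sub>v (card J)" if "x \<in> carrier_vec (card J)" "A *\<^sub>v x = 0\<^sub>v n" for x
    using nz ev_nz that by metis
  show "linear_code n (range ev)" "code_dim n (range ev) = card J"
    unfolding range using matrix_code[OF A inj] by auto
  let ?M = "{hamming_dist n x y |x y. x \<in> range ev \<and> y \<in> range ev \<and> x \<noteq> y}"
  show "min_dist n (range ev) = n - z"
    unfolding min_dist_def
  proof (rule Min_eqI)
    have "hamming_dist n x y \<le> n" for x y :: "'a vec"
      unfolding hamming_dist_def using card_mono[of "{..<n}" "{i. i < n \<and> x $ i \<noteq> y $ i}"] by auto
    hence "?M \<subseteq> {..n}"
      by auto
    thus "finite ?M"
      by (rule finite_subset) simp
    show "n - z \<le> d" if d_in: "d \<in> ?M" for d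
    proof -
      obtain g g' where d: "d = hamming_dist n (ev g) (ev g')" and neq: "ev g \<noteq> ev g'"
        using d_in by auto
      have "\<exists>j\<in>J. g j - g' j \<noteq> 0"
      proof (rule ccontr)
        assume "\<not> ?thesis"
        hence "pt_val g p = pt_val g' p" for p
          unfolding pt_val_def by (intro sum.cong) auto
        thus False
          using neq by (simp add: ev_def)
      qed
      thus ?thesis
        unfolding d hamming_dist_ev by (intro diff_le_mono2 zeros_le)
    qed
    have "hamming_dist n (ev g0) (ev (\<lambda>_. 0)) = n - z"
      unfolding hamming_dist_ev using zeros_eq by simp
    moreover from this have "ev g0 \<noteq> ev (\<lambda>_. 0)"
      using \<open>z < n\<close> by (auto simp: hamming_dist_def)
    ultimately show "n - z \<in> ?M"
      by (intro CollectI exI[of _ "ev g0"] exI[of _ "ev (\<lambda>_. 0)"]) auto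
  qed
qed

text \<open>Each point lies in the support of a short dual codeword.\<close>

lemma locality:
  assumes dual: "\<And>p. p \<in> P \<Longrightarrow> \<exists>Q\<subseteq>P. \<exists>y. p \<in> Q \<and> card Q \<le> Suc r \<and> y p \<noteq> 0 \<and>
    (\<forall>j\<in>J. (\<Sum>p'\<in>Q. y p' * F j p') = 0)"
  shows "has_locality n (range ev) r"
  unfolding has_locality_def
proof (intro allI impI)
  fix i assume i: "i < n"
  hence "pt i \<in> P"
    using pt by (auto simp: bij_betw_def)
  then obtain Q y where Q: "Q \<subseteq> P" "pt i \<in> Q" "card Q \<le> Suc r" and y: "y (pt i) \<noteq> 0"
    and rel: "\<And>j. j \<in> J \<Longrightarrow> (\<Sum>p'\<in>Q. y p' * F j p') = 0"
    using dual by metis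
  have "finite Q"
    using Q(1) finite_P finite_subset by blast
  \<comment> \<open>The recovery set consists of the positions of the other points of
    \<open>Q\<close>.\<close>
  define I where "I = {i'. i' < n \<and> pt i' \<in> Q - {pt i}}"
  have "card I = card {p \<in> P. p \<in> Q - {pt i}}"
    unfolding I_def by (rule card_indices)
  also have "{p \<in> P. p \<in> Q - {pt i}} = Q - {pt i}"
    using Q(1) by blast
  finally have card_I: "card I \<le> r"
    using Q \<open>finite Q\<close> by simp
  have key: "pt_val g (pt i) = pt_val g' (pt i)"
    if eq: "\<And>i'. i' \<in> I \<Longrightarrow> ev g $ i' = ev g' $ i'" for g g'
  proof -
    define d where "d = pt_val (\<lambda>j. g j - g' j)"
    have d0: "d p = 0" if p: "p \<in> Q - {pt i}" for p
    proof -
      have "p \<in> pt ` {..<n}"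
        using p Q(1) bij_betw_imp_surj_on[OF pt] by blast
      then obtain i' where "i' < n" "p = pt i'"
        by auto
      thus ?thesis
        using eq[of i'] p by (simp add: I_def ev_def d_def pt_val_diff)
    qed
    have "(\<Sum>p\<in>Q. y p * d p) = (\<Sum>p\<in>Q. \<Sum>j\<in>J. (g j - g' j) * (y p * F j p))"
      by (simp add: d_def pt_val_def sum_distrib_left mult.left_commute)
    also have "\<dots> = (\<Sum>j\<in>J. (g j - g' j) * (\<Sum>p\<in>Q. y p * F j p))"
      by (subst sum.swap) (simp add: sum_distrib_left)
    also have "\<dots> = 0"
      by (simp add: rel)
    finally have "(\<Sum>p\<in>Q. y p * d p) = 0" .
    \<comment> \<open>The difference vanishes at all other points of \<open>Q\<close>, so the
      relation retains a single term, whose weight is nonzero.\<close>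
    moreover have "(\<Sum>p\<in>Q. y p * d p) = y (pt i) * d (pt i)"
      using \<open>finite Q\<close> Q(2) d0 by (subst sum.remove[of _ "pt i"]) auto
    ultimately show ?thesis
      using y by (simp add: d_def pt_val_diff)
  qed
  have disj: "c $ i = c' $ i"
    if c: "c \<in> range ev" "c' \<in> range ev" and eq: "restrict (($) c) I = restrict (($) c') I" for c c'
  proof -
    obtain g where g: "c = ev g"
      using c(1) by blast
    obtain g' where g': "c' = ev g'"
      using c(2) by blast
    have "ev g $ i' = ev g' $ i'" if "i' \<in> I" for i'
      using fun_cong[OF eq, of i'] that by (simp add: g g')
    hence "pt_val g (pt i) = pt_val g' (pt i)"
      by (rule key)
    thus ?thesis
      using i by (simp add: g g' ev_def)
  qed
  show "\<exists>I\<subseteq>{..<n} - {i}. card I \<le> r \<and>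
      (\<forall>\<alpha> \<beta>. \<alpha> \<noteq> \<beta> \<longrightarrow>
        (\<lambda>c. restrict (($) c) I) ` {c \<in> range ev. c $ i = \<alpha>} \<inter>
        (\<lambda>c. restrict (($) c) I) ` {c \<in> range ev. c $ i = \<beta>} = {})"
  proof (intro exI[of _ I] conjI allI impI)
    show "card I \<le> r"
      by (fact card_I)
    fix \<alpha> \<beta> :: 'a assume "\<alpha> \<noteq> \<beta>"
    thus "(\<lambda>c. restrict (($) c) I) ` {c \<in> range ev. c $ i = \<alpha>} \<inter>
        (\<lambda>c. restrict (($) c) I) ` {c \<in> range ev. c $ i = \<beta>} = {}"
      using disj by blast
  qed (auto simp: I_def)
qed

end

section \<open>The code on the Fermat cubic\<close>

text \<open>A pair \<open>(h, e)\<close> stands for the monomial \<open>u\<^sup>e v\<^sup>h\<close>.  Modulo \<open>v\<^sup>3 = 1 - u\<^sup>3\<close> the polynomials of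
  degree at most \<open>D\<close> are spanned by \<open>h \<le> 2\<close>, \<open>e + h \<le> D\<close>; the monomials with \<open>h = 2\<close> and
  \<open>e mod 3 = 2\<close> are dropped for the sake of locality, which for \<open>3 dvd D\<close> includes \<open>e = D - 1\<close>.\<close>

definition exps :: "nat \<Rightarrow> nat \<Rightarrow> nat set" where
  "exps D h = (if h = 0 then {..D} else if h = 1 then {..<D} else {e. e < D \<and> e mod 3 \<noteq> 2})"

definition monomials :: "nat \<Rightarrow> (nat \<times> nat) set" where
  "monomials D = Sigma {..2} (exps D)"

definition monomial_val :: "nat \<times> nat \<Rightarrow> 'a::comm_monoid_mult \<times> 'a \<Rightarrow> 'a" where
  "monomial_val = (\<lambda>(h, e) (u, v). u ^ e * v ^ h)"

lemma atMost_2: "{..2::nat} = {0, 1, 2}"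
  by auto

lemma finite_exps [simp]: "finite (exps D h)"
  by (simp add: exps_def)

lemma finite_monomials [simp]: "finite (monomials D)"
  by (simp add: monomials_def)

text \<open>Each block of three consecutive exponents loses the one congruent to 2.\<close>

lemma card_exps_2: "card (exps (3 * s) 2) = 2 * s"
proof (induction s)
  case (Suc s)
  have "exps (3 * Suc s) 2 = exps (3 * s) 2 \<union> {3 * s, 3 * s + 1}"
  proof (rule Set.set_eqI)
    fix e
    have "e < 3 * Suc s \<and> e mod 3 \<noteq> 2 \<longleftrightarrow> e < 3 * s \<and> e mod 3 \<noteq> 2 \<or> e = 3 * s \<or> e = 3 * s + 1"
      by presburger
    thus "e \<in> exps (3 * Suc s) 2 \<longleftrightarrow> e \<in> exps (3 * s) 2 \<union> {3 * s, 3 * s + 1}"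
      by (auto simp: exps_def)
  qed
  moreover have "exps (3 * s) 2 \<inter> {3 * s, 3 * s + 1} = {}"
    by (auto simp: exps_def)
  ultimately show ?case
    using Suc.IH by (simp add: card_Un_disjoint)
qed (simp add: exps_def)

text \<open>The powers v^0, v^1, v^2 contribute 3s + 1, 3s and 2s monomials; for s = t - 1 the total
  is 8t - 7.\<close>

lemma card_monomials: "card (monomials (3 * s)) = 8 * s + 1"
proof -
  have "card (monomials (3 * s)) = card (exps (3 * s) 0) + card (exps (3 * s) 1) + card (exps (3 * s) 2)"
    by (simp add: monomials_def atMost_2)
  thus ?thesis
    by (simp only: card_exps_2) (simp add: exps_def)
qed

definition coeff_poly :: "(nat \<times> nat \<Rightarrow> 'a::comm_ring_1) \<Rightarrow> nat \<Rightarrow> nat \<Rightarrow> 'a poly" where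
  "coeff_poly g D h = (\<Sum>e\<in>exps D h. Polynomial.monom (g (h, e)) e)"

lemma coeff_coeff_poly: "poly.coeff (coeff_poly g D h) e = (if e \<in> exps D h then g (h, e) else 0)"
  by (simp add: coeff_poly_def coeff_sum if_distrib cong: if_cong)

lemma sum_monomials:
  "(\<Sum>j\<in>monomials D. g j * monomial_val j (u, v)) =
    poly (coeff_poly g D 0) u + poly (coeff_poly g D 1) u * v + poly (coeff_poly g D 2) u * v\<^sup>2"
proof -
  have "(\<Sum>j\<in>monomials D. g j * monomial_val j (u, v)) =
      (\<Sum>h\<in>{..2}. \<Sum>e\<in>exps D h. g (h, e) * monomial_val (h, e) (u, v))"
    unfolding monomials_def by (subst sum.Sigma) auto
  also have "\<dots> = (\<Sum>h\<in>{..2}. poly (coeff_poly g D h) u * v ^ h)"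
    by (simp add: coeff_poly_def poly_sum poly_monom monomial_val_def sum_distrib_right mult.assoc)
  finally show ?thesis
    by (simp add: atMost_2)
qed

lemma degree_coeff_poly_le:
  assumes "\<And>e. e \<in> exps D h \<Longrightarrow> e \<le> B"
  shows "degree (coeff_poly g D h) \<le> B"
proof (rule degree_le, intro allI impI)
  fix e assume "B < e"
  thus "poly.coeff (coeff_poly g D h) e = 0"
    using assms[of e] by (auto simp: coeff_coeff_poly)
qed

text \<open>The zero bound is applied with D = 3s. The case \<open>s = 0\<close> is separated
  because the components of v and v^2 are then empty.\<close>

lemma card_zeros_monomials:
  fixes g :: "nat \<times> nat \<Rightarrow> 'a::{field,finite}"
  assumes "(3::'a) \<noteq> 0" and "\<exists>j\<in>monomials (3 * s). g j \<noteq> 0"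
  shows "card {(u, v). u ^ 3 + v ^ 3 = 1 \<and> (\<Sum>j\<in>monomials (3 * s). g j * monomial_val j (u, v)) = 0}
    \<le> 9 * s"
proof -
  let ?f = "coeff_poly g (3 * s)"
  obtain h e where he: "h \<le> 2" "e \<in> exps (3 * s) h" "g (h, e) \<noteq> 0"
    using assms(2) by (auto simp: monomials_def)
  hence "poly.coeff (?f h) e \<noteq> 0"
    by (simp add: coeff_coeff_poly)
  hence "?f h \<noteq> 0"
    by auto
  hence nz: "?f 0 \<noteq> 0 \<or> ?f 1 \<noteq> 0 \<or> ?f 2 \<noteq> 0"
    using he(1) by (auto simp: le_Suc_eq numeral_2_eq_2)
  have "degree (?f 0) \<le> 3 * s"
    by (rule degree_coeff_poly_le) (simp add: exps_def)
  moreover have "?f 1 = 0 \<or> degree (?f 1) + 1 \<le> 3 * s"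
  proof (cases "s = 0")
    case False
    have "degree (?f 1) \<le> 3 * s - 1"
      by (rule degree_coeff_poly_le) (auto simp: exps_def)
    hence "degree (?f 1) + 1 \<le> 3 * s"
      using False by linarith
    thus ?thesis ..
  qed (simp add: coeff_poly_def exps_def)
  moreover have "?f 2 = 0 \<or> degree (?f 2) + 2 \<le> 3 * s"
  proof (cases "s = 0")
    case False
    \<comment> \<open>The exponent 3s - 1 is congruent to 2 modulo 3 and hence dropped, which gains
      the extra unit.\<close>
    have "degree (?f 2) \<le> 3 * s - 2"
    proof (rule degree_coeff_poly_le)
      fix e assume "e \<in> exps (3 * s) 2"
      hence "e < 3 * s" "e mod 3 \<noteq> 2"
        by (auto simp: exps_def)
      thus "e \<le> 3 * s - 2"
        by presburger
    qed
    hence "degree (?f 2) + 2 \<le> 3 * s"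
      using False by linarith
    thus ?thesis ..
  qed (simp add: coeff_poly_def exps_def)
  ultimately show ?thesis
    unfolding sum_monomials using card_zeros_on_fermat_cubic[OF assms(1) nz, of "3 * s"] by simp
qed

section \<open>Repair groups as fibres of u^3\<close>

context char_two_field
begin

text \<open>These are the \<open>c\<close> for which \<open>c\<close> and \<open>1 - c\<close> are
  both nonzero cubes, that is, the points over which the quotient map has nine rational
  preimages.\<close>

definition split_values :: "'a set" where
  "split_values = (\<lambda>(u, v). u ^ 3) ` fermat_points"

text \<open>Fixing u^3 = c fixes v^3 = 1 - c, so the fibre is a product of two cubing
  fibres.\<close>

lemma fibre:
  assumes "c \<in> split_values"
  obtains u0 v0 where "{(u, v). u ^ 3 = c \<and> u ^ 3 + v ^ 3 = 1} = {u. u ^ 3 = u0 ^ 3} \<times> {v. v ^ 3 = v0 ^ 3}"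
    "u0 \<noteq> 0" "v0 \<noteq> 0" "u0 ^ 3 = c" "u0 ^ 3 + v0 ^ 3 = 1"
proof -
  obtain u0 v0 where uv: "u0 \<noteq> 0" "v0 \<noteq> 0" "u0 ^ 3 = c" "u0 ^ 3 + v0 ^ 3 = 1"
    using assms by (auto simp: split_values_def fermat_points_def)
  have "u ^ 3 = c \<and> u ^ 3 + v ^ 3 = 1 \<longleftrightarrow> u ^ 3 = u0 ^ 3 \<and> v ^ 3 = v0 ^ 3" for u v
    using uv(3,4) by (metis add_left_cancel)
  hence "{(u, v). u ^ 3 = c \<and> u ^ 3 + v ^ 3 = 1} = {u. u ^ 3 = u0 ^ 3} \<times> {v. v ^ 3 = v0 ^ 3}"
    by blast
  thus ?thesis
    by (rule that[OF _ uv])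
qed

lemma card_fibre:
  assumes "c \<in> split_values"
  shows "card {(u, v). u ^ 3 = c \<and> u ^ 3 + v ^ 3 = 1} = 9"
proof -
  obtain u0 v0 where fib: "{(u, v). u ^ 3 = c \<and> u ^ 3 + v ^ 3 = 1} = {u. u ^ 3 = u0 ^ 3} \<times> {v. v ^ 3 = v0 ^ 3}"
    and nz: "u0 \<noteq> 0" "v0 \<noteq> 0"
    using fibre[OF assms] by blast
  show ?thesis
    unfolding fib card_cartesian_product card_cube_roots[OF nz(1)] card_cube_roots[OF nz(2)] by simp
qed

lemma card_fibres:
  assumes "S \<subseteq> split_values"
  shows "card {(u, v). u ^ 3 \<in> S \<and> u ^ 3 + v ^ 3 = 1} = 9 * card S"
proof -
  have "{(u, v). u ^ 3 \<in> S \<and> u ^ 3 + v ^ 3 = 1} = (\<Union>c\<in>S. {(u, v). u ^ 3 = c \<and> u ^ 3 + v ^ 3 = 1})"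
    by auto
  also have "card \<dots> = (\<Sum>c\<in>S. card {(u, v::'a). u ^ 3 = c \<and> u ^ 3 + v ^ 3 = 1})"
    by (rule card_UN_disjoint) auto
  also have "\<dots> = (\<Sum>c\<in>S. 9)"
    using assms by (intro sum.cong refl card_fibre) blast
  finally show ?thesis
    by simp
qed

lemma card_split_values:
  assumes "card (UNIV :: 'a set) = s\<^sup>2" and "s mod 3 = 2"
  shows "s\<^sup>2 + 2 * s \<le> 9 * card split_values + 8"
proof -
  have "fermat_points \<subseteq> {(u, v). u ^ 3 \<in> split_values \<and> u ^ 3 + v ^ 3 = 1}"
    by (auto simp: split_values_def fermat_points_def)
  hence "card fermat_points \<le> 9 * card split_values"
    using card_mono[of "{(u, v). u ^ 3 \<in> split_values \<and> u ^ 3 + v ^ 3 = 1}" fermat_points]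
      card_fibres[of split_values] by simp
  thus ?thesis
    using card_fermat_points[OF assms] by linarith
qed

text \<open>The weight u v raises both exponents by one, and the sum factors into two power sums
  over cubing fibres. One of them vanishes unless 3 divides both e + 1 and h + 1, which happens only
  for the dropped monomials.\<close>

lemma sum_fibre_monomial:
  assumes "c \<in> split_values" "j \<in> monomials D"
  shows "(\<Sum>p | fst p ^ 3 = c \<and> fst p ^ 3 + snd p ^ 3 = 1. (fst p * snd p) * monomial_val j p) = 0"
proof -
  obtain h e where j: "j = (h, e)" "h \<le> 2" "e \<in> exps D h"
    using assms(2) by (auto simp: monomials_def)
  obtain u0 v0 where fib: "{(u, v). u ^ 3 = c \<and> u ^ 3 + v ^ 3 = 1} = {u. u ^ 3 = u0 ^ 3} \<times> {v. v ^ 3 = v0 ^ 3}"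
    using fibre[OF assms(1)] by blast
  have "(\<Sum>p | fst p ^ 3 = c \<and> fst p ^ 3 + snd p ^ 3 = 1. (fst p * snd p) * monomial_val j p)
      = (\<Sum>(u, v)\<in>{u. u ^ 3 = u0 ^ 3} \<times> {v. v ^ 3 = v0 ^ 3}. u ^ Suc e * v ^ Suc h)"
    unfolding fib[symmetric] by (rule sum.cong) (auto simp: j(1) monomial_val_def)
  also have "\<dots> = (\<Sum>u | u ^ 3 = u0 ^ 3. u ^ Suc e) * (\<Sum>v | v ^ 3 = v0 ^ 3. v ^ Suc h)"
    by (simp only: sum.cartesian_product[symmetric] sum_product)
  also have "\<not> 3 dvd Suc e \<or> \<not> 3 dvd Suc h"
  proof (cases "h = 2")
    case True
    hence "e mod 3 \<noteq> 2"
      using j(3) by (simp add: exps_def)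
    thus ?thesis
      by presburger
  next
    case False
    thus ?thesis
      using j(2) by presburger
  qed
  hence "(\<Sum>u | u ^ 3 = u0 ^ 3. u ^ Suc e) * (\<Sum>v | v ^ 3 = v0 ^ 3. v ^ Suc h) = 0"
    using sum_power_cube_roots by (metis mult_eq_0_iff)
  finally show ?thesis .
qed

text \<open>The zero bound 9s is attained by the product of u^3 - c over \<open>s\<close> values
  \<open>c\<close> in \<open>S\<close>, which vanishes on exactly \<open>s\<close> of the repair
  groups and lies in the function space, having degree at most 3s in u alone.\<close>

lemma exists_code:
  assumes S: "S \<subseteq> split_values" and s: "s < card S"
  shows "\<exists>C :: 'a vec set. linear_code (9 * card S) C \<and> code_dim (9 * card S) C = 8 * s + 1 \<and>
    min_dist (9 * card S) C = 9 * card S - 9 * s \<and> has_locality (9 * card S) C 8"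
proof -
  define P where "P = {(u, v). u ^ 3 \<in> S \<and> u ^ 3 + v ^ 3 = 1}"
  define n where "n = 9 * card S"
  have "finite P" "card P = n"
    using card_fibres[OF S] by (simp_all add: P_def n_def)
  then obtain pt where pt: "bij_betw pt {..<n} P"
    using ex_bij_betw_nat_finite[of P] by (auto simp: atLeast0LessThan)
  interpret evaluation_code "monomials (3 * s)" monomial_val P pt n
    by unfold_locales (simp_all add: pt)
  obtain T where T: "T \<subseteq> S" "card T = s"
    using s obtain_subset_with_card_n[of s S] by (metis less_imp_le)
  define f where "f = (\<Prod>c\<in>T. Polynomial.monom 1 3 - [:c:])"
  have deg: "degree (Polynomial.monom 1 3 - [:c:]) \<le> 3" for c :: 'a
    by (rule degree_diff_le) (auto simp: degree_monom_le)
  have "degree f \<le> (\<Sum>c\<in>T. degree (Polynomial.monom 1 3 - [:c:]))"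
    unfolding f_def using degree_prod_sum_le[of T "\<lambda>c. Polynomial.monom 1 3 - [:c:]"] by (simp add: o_def)
  also have "\<dots> \<le> (\<Sum>c\<in>T. 3)"
    by (rule sum_mono) (rule deg)
  finally have deg_f: "degree f \<le> 3 * s"
    using T(2) by simp
  define g0 where "g0 = (\<lambda>(h, e). if h = (0::nat) then poly.coeff f e else 0)"
  have "coeff_poly g0 (3 * s) 0 = f"
    using deg_f by (intro poly_eqI) (auto simp: coeff_coeff_poly g0_def exps_def coeff_eq_0)
  moreover have "coeff_poly g0 (3 * s) 1 = 0" "coeff_poly g0 (3 * s) 2 = 0"
    by (simp_all add: coeff_poly_def g0_def)
  ultimately have val_g0: "pt_val g0 (u, v) = (\<Prod>c\<in>T. u ^ 3 - c)" for u v
    by (simp add: pt_val_def sum_monomials f_def poly_prod poly_monom)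
  have "{p \<in> P. pt_val g0 p = 0} = {(u, v). u ^ 3 \<in> T \<and> u ^ 3 + v ^ 3 = 1}"
    using T(1) by (auto simp: val_g0 P_def)
  hence zeros_eq: "card {p \<in> P. pt_val g0 p = 0} = 9 * s"
    using card_fibres[of T] T S by auto
  have zeros_le: "card {p \<in> P. pt_val g p = 0} \<le> 9 * s" if "\<exists>j\<in>monomials (3 * s). g j \<noteq> 0" for g
  proof -
    have "{p \<in> P. pt_val g p = 0} \<subseteq>
        {(u, v). u ^ 3 + v ^ 3 = 1 \<and> (\<Sum>j\<in>monomials (3 * s). g j * monomial_val j (u, v)) = 0}"
      by (auto simp: P_def pt_val_def)
    hence "card {p \<in> P. pt_val g p = 0} \<le>
        card {(u, v). u ^ 3 + v ^ 3 = 1 \<and> (\<Sum>j\<in>monomials (3 * s). g j * monomial_val j (u, v)) = 0}"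
      by (intro card_mono) auto
    also have "\<dots> \<le> 9 * s"
      by (rule card_zeros_monomials[OF three_neq_0 that])
    finally show ?thesis .
  qed
  have "has_locality n (range ev) 8"
  proof (rule locality)
    fix p assume "p \<in> P"
    then obtain u v where p: "p = (u, v)" "u ^ 3 \<in> S" "u ^ 3 + v ^ 3 = 1"
      by (auto simp: P_def)
    have c: "u ^ 3 \<in> split_values"
      using p(2) S by blast
    define Q where "Q = {p'. fst p' ^ 3 = u ^ 3 \<and> fst p' ^ 3 + snd p' ^ 3 = 1}"
    have Q_eq: "Q = {(u', v'). u' ^ 3 = u ^ 3 \<and> u' ^ 3 + v' ^ 3 = 1}"
      by (auto simp: Q_def)
    have "Q \<subseteq> P"
      using p(2) by (auto simp: Q_eq P_def)
    moreover have "p \<in> Q"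
      using p by (simp add: Q_eq)
    moreover have "card Q \<le> Suc 8"
      using card_fibre[OF c] by (simp add: Q_eq)
    \<comment> \<open>Fibres over split values avoid both coordinate axes.\<close>
    moreover have "fst p * snd p \<noteq> 0"
    proof -
      obtain u0 v0 where "{(u', v'). u' ^ 3 = u ^ 3 \<and> u' ^ 3 + v' ^ 3 = 1} = {u. u ^ 3 = u0 ^ 3} \<times> {v. v ^ 3 = v0 ^ 3}"
        and "u0 \<noteq> 0" "v0 \<noteq> 0"
        using fibre[OF c] by blast
      moreover have "(u, v) \<in> {(u', v'). u' ^ 3 = u ^ 3 \<and> u' ^ 3 + v' ^ 3 = 1}"
        using p(3) by simp
      ultimately have "u ^ 3 = u0 ^ 3" "v ^ 3 = v0 ^ 3"
        by auto
      thus ?thesis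
        using p(1) \<open>u0 \<noteq> 0\<close> \<open>v0 \<noteq> 0\<close> by auto
    qed
    moreover have "\<forall>j\<in>monomials (3 * s). (\<Sum>p'\<in>Q. (fst p' * snd p') * monomial_val j p') = 0"
      unfolding Q_def using sum_fibre_monomial[OF c] by blast
    ultimately show "\<exists>Q\<subseteq>P. \<exists>y. p \<in> Q \<and> card Q \<le> Suc 8 \<and> y p \<noteq> 0 \<and>
        (\<forall>j\<in>monomials (3 * s). (\<Sum>p'\<in>Q. y p' * monomial_val j p') = 0)"
      by (intro exI[of _ Q] conjI exI[of _ "\<lambda>p. fst p * snd p"]) assumption+
  qed
  moreover have "9 * s < n"
    using s by (simp add: n_def)
  ultimately show ?thesis
    using parameters[OF zeros_le zeros_eq] card_monomials[of s] unfolding n_def by metis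
qed

end

section \<open>Choice of the repair groups and optimality for odd powers of 4\<close>

theorem theorem4p12:
  fixes a q :: nat
  assumes "q = 4 ^ (2 * a + 1)"
    and "card (UNIV :: 'f::{field,finite} set) = q"
  shows "\<forall>t m :: nat. 1 \<le> t \<and> t \<le> m \<and> real m \<le> (real q + 2 * sqrt (real q) - 8) / 9 \<longrightarrow>
    (\<exists>(n::nat) (k::nat) (d::nat) (r::nat) (C :: 'f vec set).
       n = 9 * m \<and> real n \<le> real q + 2 * sqrt (real q) - real r \<and>
       int k = 8 * int t - 7 \<and>
       int d = int n - 9 * int t + 9 \<and>
       r = 8 \<and>
       is_optimal_lrc n k d r C)"
proof (intro allI impI)
  fix t m :: nat
  assume tm: "1 \<le> t \<and> t \<le> m \<and> real m \<le> (real q + 2 * sqrt (real q) - 8) / 9"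
  \<comment> \<open>The square root of \<open>q\<close>. The odd exponent supplies the factor 2, so
    it is congruent to 2 modulo 3 and the exponential sum has positive sign.\<close>
  define s :: nat where "s = 2 * 4 ^ a"
  have q: "q = s\<^sup>2"
    by (simp add: assms(1) s_def power_mult_distrib power_mult[symmetric] mult.commute power_add)
  have mod: "4 ^ j mod 3 = (1::nat)" for j
    by (simp flip: power_mod)
  have "s mod 3 = 2"
    unfolding s_def using mod[of a] by presburger
  have "3 dvd card (UNIV :: 'f set) - 1"
    using mod[of "2 * a + 1"] unfolding assms by presburger
  then obtain w :: 'f where w: "w\<^sup>2 + w + 1 = 0"
    by (rule exists_primitive_cube_root)
  have "card (UNIV :: 'f set) = 2 ^ (2 * (2 * a + 1))"
    by (simp only: assms power_mult) simp
  hence two: "(2::'f) = 0"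
    by (rule char_two_of_card)
  have "(3::'f) = 2 + 1"
    by simp
  hence "(3::'f) \<noteq> 0"
    using two by simp
  interpret char_two_field w
    by unfold_locales (fact w \<open>(3::'f) \<noteq> 0\<close> two)+
  have sqrt: "sqrt (real q) = real s"
    by (simp add: q)
  have "9 * real m \<le> real q + 2 * real s - 8"
    using tm by (simp add: sqrt)
  hence "9 * m + 8 \<le> s\<^sup>2 + 2 * s"
    unfolding q by linarith
  also have "\<dots> \<le> 9 * card split_values + 8"
    using card_split_values[of s] assms(2) q \<open>s mod 3 = 2\<close> by simp
  \<comment> \<open>There are at least \<open>m\<close> split values, each providing one repair
    group of nine points.\<close>
  finally obtain S where S: "S \<subseteq> split_values" "card S = m"
    using obtain_subset_with_card_n[of m split_values] by auto
  have t: "t - 1 < card S"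
    using tm S(2) by linarith
  obtain C :: "'f vec set" where C: "linear_code (9 * m) C" "code_dim (9 * m) C = 8 * (t - 1) + 1"
    "min_dist (9 * m) C = 9 * m - 9 * (t - 1)" "has_locality (9 * m) C 8"
    using exists_code[OF S(1) t] unfolding S(2) by blast
  \<comment> \<open>The quotient is t - 7/8, which lies above t - 1 and below t.\<close>
  have ceil: "\<lceil>real (8 * (t - 1) + 1) / real 8\<rceil> = int t"
    by (rule ceiling_unique) (use tm in \<open>auto simp: of_nat_diff field_simps\<close>)
  show "\<exists>(n::nat) (k::nat) (d::nat) (r::nat) (C :: 'f vec set).
       n = 9 * m \<and> real n \<le> real q + 2 * sqrt (real q) - real r \<and>
       int k = 8 * int t - 7 \<and> int d = int n - 9 * int t + 9 \<and> r = 8 \<and> is_optimal_lrc n k d r C"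
  proof (intro exI conjI)
    show "real (9 * m) \<le> real q + 2 * sqrt (real q) - real 8"
      using tm by simp
    show "int (8 * (t - 1) + 1) = 8 * int t - 7" "int (9 * m - 9 * (t - 1)) = int (9 * m) - 9 * int t + 9"
      using tm by (auto simp: of_nat_diff)
    have "int (9 * m - 9 * (t - 1)) = int (9 * m) - int (8 * (t - 1) + 1) - int t + 2"
      using tm by (auto simp: of_nat_diff)
    thus "is_optimal_lrc (9 * m) (8 * (t - 1) + 1) (9 * m - 9 * (t - 1)) 8 C"
      unfolding is_optimal_lrc_def is_lrc_def ceil using C by blast
  qed simp_all
qed

end
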